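(* Let $\mathcal{H}$ be a complex Hilbert space, let $A\in\mathcal{B}(\mathcal{H})$ be positive (semi-definite), let $\mathbb{A}=\begin{pmatrix}A&0\\0&A\end{pmatrix}$, and let $P,Q,R,S\in\mathcal{B}_{A^{1/2}}(\mathcal{H})$. Then $$\lambda_1\le \omega_{\mathbb{A}}\left[\begin{pmatrix}P&Q\\R&S\end{pmatrix}\right]\le\lambda_2,$$ where $$\lambda_1=\max\left\{\omega_{\mathbb{A}}\left[\begin{pmatrix}0&Q\\R&0\end{pmatrix}\right],\ \max\{\omega_A(P),\omega_A(S)\}\right\}$$ and $$\lambda_2=\frac{\|Q\|_A+\|R\|_A}{2}+\max\{\omega_A(P),\omega_A(S)\}.$$
   Context: $\mathcal{B}(\mathcal{H})$ is the algebra of bounded linear operators on $\mathcal{H}$. The positive semi-definite operator $A$ induces the semi-inner product $\langle x\mid y\rangle_A=\langle Ax\mid y\rangle$ and the seminorm $\|x\|_A=\langle x\mid x\rangle_A^{1/2}=\|A^{1/2}x\|$. $\mathcal{B}_{A^{1/2}}(\mathcal{H})$ is the set of $A$-bounded operators: those $T\in\mathcal{B}(\mathcal{H})$ for which there is $\lambda>0$ with $\|Tx\|_A\le\lambda\|x\|_A$ for all $x\in\mathcal{H}$. For such $T$, $\|T\|_A=\sup\{\|Tx\|_A : x\in\mathcal{H},\ \|x\|_A=1\}$. The $A$-numerical radius is $\omega_A(T)=\sup\{|\langle Tx\mid x\rangle_A| : x\in\mathcal{H},\ \|x\|_A=1\}$. The operator $\mathbb{A}$ is a positive operator on $\mathcal{H}\oplus\mathcal{H}$,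 with $\langle x,y\rangle_{\mathbb{A}}=\langle x_1\mid y_1\rangle_A+\langle x_2\mid y_2\rangle_A$ for $x=(x_1,x_2)$, $y=(y_1,y_2)$; $\|\cdot\|_{\mathbb{A}}$ and $\omega_{\mathbb{A}}$ are defined in the same way with $(\mathcal{H}\oplus\mathcal{H},\mathbb{A})$ in place of $(\mathcal{H},A)$. A $2\times2$ matrix of operators on $\mathcal{H}$ denotes the corresponding operator on $\mathcal{H}\oplus\mathcal{H}$. *)

theory Defs
  imports "HOL-Analysis.Analysis" "HOL-Library.Nonpos_Ints"
begin

section \<open>Complex Hilbert spaces\<close>

class scaleC =
  fixes scaleC :: "complex \<Rightarrow> 'a \<Rightarrow> 'a" (infixr \<open>*\<^sub>C\<close> 75)

class complex_vector = real_vector + scaleC +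
  assumes scaleC_add_right: "a *\<^sub>C (x + y) = a *\<^sub>C x + a *\<^sub>C y"
    and scaleC_add_left: "(a + b) *\<^sub>C x = a *\<^sub>C x + b *\<^sub>C x"
    and scaleC_scaleC: "a *\<^sub>C b *\<^sub>C x = (a * b) *\<^sub>C x"
    and scaleC_one: "1 *\<^sub>C x = x"
    and scaleR_scaleC: "r *\<^sub>R x = complex_of_real r *\<^sub>C x"

text \<open>
  The inner product is linear in the first argument. Every complex inner product space carries
  the underlying real structure required by \<^class>\<open>real_inner\<close>: the real inner product is the
  real part of the complex one, so both induce the same norm. Positive definiteness of
  \<open>cinner\<close> follows from that of \<^const>\<open>inner\<close>, see \<open>cinner_self\<close> below.
\<close>

class complex_inner = complex_vector + real_inner +
  fixes cinner :: "'a \<Rightarrow> 'a \<Rightarrow> complex"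
  assumes cinner_commute: "cinner x y = cnj (cinner y x)"
    and cinner_add_left: "cinner (x + y) z = cinner x z + cinner y z"
    and cinner_scaleC_left: "cinner (a *\<^sub>C x) y = a * cinner x y"
    and inner_eq_Re_cinner: "inner x y = Re (cinner x y)"

class chilbert_space = complex_inner + complete_space

lemma cinner_self: "cinner x x = complex_of_real ((norm x)\<^sup>2)"
  for x :: "'a::complex_inner"
proof (rule complex_eqI)
  show "Re (cinner x x) = Re (complex_of_real ((norm x)\<^sup>2))"
    by (simp add: power2_norm_eq_inner flip: inner_eq_Re_cinner)
  show "Im (cinner x x) = Im (complex_of_real ((norm x)\<^sup>2))"
    using arg_cong[OF cinner_commute[of x x], of Im] by simp
qed

instantiation complex :: chilbert_space
begin

definition scaleC_complex :: "complex \<Rightarrow> complex \<Rightarrow> complex"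
  where "scaleC_complex a x = a * x"

definition cinner_complex :: "complex \<Rightarrow> complex \<Rightarrow> complex"
  where "cinner_complex x y = x * cnj y"

instance
  by standard
    (simp_all add: scaleC_complex_def cinner_complex_def algebra_simps scaleR_conv_of_real
      inner_complex_def)

end

text \<open>The product type is the orthogonal (Hilbert) direct sum.\<close>

instantiation prod :: (complex_vector, complex_vector) complex_vector
begin

definition scaleC_prod :: "complex \<Rightarrow> 'a \<times> 'b \<Rightarrow> 'a \<times> 'b"
  where "scaleC_prod a x = (a *\<^sub>C fst x, a *\<^sub>C snd x)"

instance
  by standard
    (simp_all add: scaleC_prod_def prod_eq_iff scaleC_add_right scaleC_add_left scaleC_scaleC
      scaleC_one scaleR_scaleC)

end

instantiation prod :: (complex_inner, complex_inner) complex_inner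
begin

definition cinner_prod :: "'a \<times> 'b \<Rightarrow> 'a \<times> 'b \<Rightarrow> complex"
  where "cinner_prod x y = cinner (fst x) (fst y) + cinner (snd x) (snd y)"

instance
proof
  fix x y z :: "'a \<times> 'b" and a :: complex
  show "cinner x y = cnj (cinner y x)"
    unfolding cinner_prod_def
    using cinner_commute[of "fst x" "fst y"] cinner_commute[of "snd x" "snd y"] by simp
  show "cinner (x + y) z = cinner x z + cinner y z"
    by (simp add: cinner_prod_def cinner_add_left)
  show "cinner (a *\<^sub>C x) y = a * cinner x y"
    by (simp add: cinner_prod_def scaleC_prod_def cinner_scaleC_left distrib_left)
  show "inner x y = Re (cinner x y)"
    by (simp add: cinner_prod_def inner_prod_def inner_eq_Re_cinner)
qed

end

instance prod :: (chilbert_space, chilbert_space) chilbert_space ..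

section \<open>Operators\<close>

definition bounded_clinear :: "('a::complex_inner \<Rightarrow> 'b::complex_inner) \<Rightarrow> bool"
  where "bounded_clinear T \<longleftrightarrow> bounded_linear T \<and> (\<forall>a x. T (a *\<^sub>C x) = a *\<^sub>C T x)"

definition positive_op :: "('a::complex_inner \<Rightarrow> 'a) \<Rightarrow> bool"
  where "positive_op A \<longleftrightarrow> bounded_clinear A \<and> (\<forall>x. cinner (A x) x \<in> \<real>\<^sub>\<ge>\<^sub>0)"

definition A_inner :: "('a::complex_inner \<Rightarrow> 'a) \<Rightarrow> 'a \<Rightarrow> 'a \<Rightarrow> complex"
  where "A_inner A x y = cinner (A x) y"

text \<open>For positive \<open>A\<close> the number \<open>A_inner A x x\<close> is real and nonnegative.\<close>

definition A_seminorm :: "('a::complex_inner \<Rightarrow> 'a) \<Rightarrow> 'a \<Rightarrow> real"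
  where "A_seminorm A x = sqrt (Re (A_inner A x x))"

definition A_bounded_ops :: "('a::complex_inner \<Rightarrow> 'a) \<Rightarrow> ('a \<Rightarrow> 'a) set"
  where "A_bounded_ops A =
    {T. bounded_clinear T \<and> (\<exists>c>0. \<forall>x. A_seminorm A (T x) \<le> c * A_seminorm A x)}"

text \<open>
  Both suprema are suprema of sets of nonnegative reals. Inserting \<open>0\<close> only matters if
  no \<open>x\<close> has \<open>A\<close>-seminorm \<open>1\<close> (that is, if \<open>A = 0\<close>), where it fixes the supremum of the
  empty set to be \<open>0\<close>. The definitions are meaningful for \<open>T \<in> A_bounded_ops A\<close>, for which the
  sets are bounded above.
\<close>

definition A_opnorm :: "('a::complex_inner \<Rightarrow> 'a) \<Rightarrow> ('a \<Rightarrow> 'a) \<Rightarrow> real"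
  where "A_opnorm A T = Sup (insert 0 {A_seminorm A (T x) | x. A_seminorm A x = 1})"

definition A_numerical_radius :: "('a::complex_inner \<Rightarrow> 'a) \<Rightarrow> ('a \<Rightarrow> 'a) \<Rightarrow> real"
  where "A_numerical_radius A T =
    Sup (insert 0 {cmod (A_inner A (T x) x) | x. A_seminorm A x = 1})"

definition block_op ::
    "('a::complex_inner \<Rightarrow> 'a) \<Rightarrow> ('a \<Rightarrow> 'a) \<Rightarrow> ('a \<Rightarrow> 'a) \<Rightarrow> ('a \<Rightarrow> 'a) \<Rightarrow> 'a \<times> 'a \<Rightarrow> 'a \<times> 'a"
  where "block_op P Q R S x = (P (fst x) + Q (snd x), R (fst x) + S (snd x))"

abbreviation zero_op :: "'a::complex_inner \<Rightarrow> 'a"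
  where "zero_op \<equiv> \<lambda>_. 0"

abbreviation diag_op :: "('a::complex_inner \<Rightarrow> 'a) \<Rightarrow> 'a \<times> 'a \<Rightarrow> 'a \<times> 'a"
  where "diag_op A \<equiv> block_op A zero_op zero_op A"

lemma A_inner_diag_op:
  "A_inner (diag_op A) x y = A_inner A (fst x) (fst y) + A_inner A (snd x) (snd y)"
  by (simp add: A_inner_def block_op_def cinner_prod_def)

end

theory Submission
  imports Defs
begin

text \<open>
  Write \<open>T = block_op P Q R S\<close> and let \<open>x = (x\<^sub>1, x\<^sub>2)\<close> be a vector with
  \<open>\<parallel>x\<^sub>1\<parallel>\<^sub>A\<^sup>2 + \<parallel>x\<^sub>2\<parallel>\<^sub>A\<^sup>2 = 1\<close>. Everything is read off from the expansion
  \<open>\<langle>T x | x\<rangle> = \<langle>P x\<^sub>1 | x\<^sub>1\<rangle>\<^sub>A + \<langle>Q x\<^sub>2 | x\<^sub>1\<rangle>\<^sub>A + \<langle>R x\<^sub>1 | x\<^sub>2\<rangle>\<^sub>A + \<langle>S x\<^sub>2 | x\<^sub>2\<rangle>\<^sub>A\<close>.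

  For the upper bound, the two diagonal terms contribute at most
  \<open>\<omega>\<^sub>A(P) \<parallel>x\<^sub>1\<parallel>\<^sub>A\<^sup>2 + \<omega>\<^sub>A(S) \<parallel>x\<^sub>2\<parallel>\<^sub>A\<^sup>2\<close>, which is at most the larger numerical radius. By the
  Cauchy-Schwarz inequality the two other terms contribute at most
  \<open>(\<parallel>Q\<parallel>\<^sub>A + \<parallel>R\<parallel>\<^sub>A) \<parallel>x\<^sub>1\<parallel>\<^sub>A \<parallel>x\<^sub>2\<parallel>\<^sub>A\<close>, and \<open>\<parallel>x\<^sub>1\<parallel>\<^sub>A \<parallel>x\<^sub>2\<parallel>\<^sub>A \<le> 1/2\<close> on the unit sphere. This
  is \<open>block_form_le\<close>.

  For the lower bound, the vectors \<open>(u, 0)\<close> and \<open>(0, v)\<close> recover the quadratic forms of \<open>P\<close> and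
  \<open>S\<close>. The reflection \<open>x' = (x\<^sub>1, -x\<^sub>2)\<close> preserves the seminorm and changes the sign of the
  off-diagonal terms only, so the quadratic form of the off-diagonal part at \<open>x\<close> is
  \<open>(\<langle>T x | x\<rangle> - \<langle>T x' | x'\<rangle>)/2\<close>, the mean of two numbers whose moduli do not exceed the numerical
  radius of \<open>T\<close>.

  Since \<open>A\<close> may have a kernel, the estimates \<open>\<parallel>T x\<parallel>\<^sub>A \<le> \<parallel>T\<parallel>\<^sub>A \<parallel>x\<parallel>\<^sub>A\<close> and
  \<open>\<bar>\<langle>T x | x\<rangle>\<^sub>A\<bar> \<le> \<omega>\<^sub>A(T) \<parallel>x\<parallel>\<^sub>A\<^sup>2\<close> do not follow from scaling alone: at vectors of seminorm \<open>0\<close>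
  they use the \<open>A\<close>-boundedness of \<open>T\<close>.
\<close>

section \<open>The semi-inner product of a positive operator\<close>

lemma cinner_add_right: "cinner x (y + z) = cinner x y + cinner x z"
  by (metis cinner_add_left cinner_commute complex_cnj_add)

lemma cinner_scaleC_right: "cinner x (a *\<^sub>C y) = cnj a * cinner x y"
  by (metis cinner_commute cinner_scaleC_left complex_cnj_mult)

lemma A_inner_add_right: "A_inner A x (y + z) = A_inner A x y + A_inner A x z"
  by (simp add: A_inner_def cinner_add_right)

lemma A_inner_scaleC_right: "A_inner A x (a *\<^sub>C y) = cnj a * A_inner A x y"
  by (simp add: A_inner_def cinner_scaleC_right)

lemma A_inner_zero_right: "A_inner A x 0 = 0"
  using A_inner_add_right[of A x 0 0] by simp

lemma A_inner_minus_right: "A_inner A x (- y) = - A_inner A x y"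
  using A_inner_add_right[of A x y "- y"]
  by (simp add: A_inner_zero_right add_eq_0_iff)

lemma bounded_clinear_add: "bounded_clinear T \<Longrightarrow> T (x + y) = T x + T y"
  by (simp add: bounded_clinear_def linear_add bounded_linear.linear)

lemma bounded_clinear_scaleC: "bounded_clinear T \<Longrightarrow> T (a *\<^sub>C x) = a *\<^sub>C T x"
  by (simp add: bounded_clinear_def)

lemma bounded_clinear_zero: "bounded_clinear T \<Longrightarrow> T 0 = 0"
  by (simp add: bounded_clinear_def linear_0 bounded_linear.linear)

lemma bounded_clinear_minus: "bounded_clinear T \<Longrightarrow> T (- x) = - T x"
  by (simp add: bounded_clinear_def linear_neg bounded_linear.linear)

lemma A_bounded_ops_clinear: "T \<in> A_bounded_ops A \<Longrightarrow> bounded_clinear T"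
  by (simp add: A_bounded_ops_def)

context
  fixes A :: "'a::complex_inner \<Rightarrow> 'a"
  assumes pos: "positive_op A"
begin

lemma clinear_A: "bounded_clinear A"
  using pos by (simp add: positive_op_def)

lemma A_inner_add_left: "A_inner A (x + y) z = A_inner A x z + A_inner A y z"
  by (simp add: A_inner_def bounded_clinear_add[OF clinear_A] cinner_add_left)

lemma A_inner_scaleC_left: "A_inner A (a *\<^sub>C x) y = a * A_inner A x y"
  by (simp add: A_inner_def bounded_clinear_scaleC[OF clinear_A] cinner_scaleC_left)

lemma A_inner_zero_left: "A_inner A 0 x = 0"
  using A_inner_add_left[of 0 0 x] by simp

lemma A_inner_minus_left: "A_inner A (- x) y = - A_inner A x y"
  using A_inner_add_left[of x "- x" y]
  by (simp add: A_inner_zero_left add_eq_0_iff)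

lemma A_inner_self_real: "Im (A_inner A x x) = 0"
  and A_inner_self_nonneg: "0 \<le> Re (A_inner A x x)"
  using pos by (simp_all add: positive_op_def A_inner_def complex_nonneg_Reals_iff)

lemma A_seminorm_sq: "(A_seminorm A x)\<^sup>2 = Re (A_inner A x x)"
  by (simp add: A_seminorm_def A_inner_self_nonneg)

lemma A_seminorm_nonneg: "0 \<le> A_seminorm A x"
  by (simp add: A_seminorm_def A_inner_self_nonneg)

lemma A_seminorm_zero: "A_seminorm A 0 = 0"
  by (simp add: A_seminorm_def A_inner_zero_left)

lemma A_seminorm_minus: "A_seminorm A (- x) = A_seminorm A x"
  by (simp add: A_seminorm_def A_inner_minus_left A_inner_minus_right)

lemma A_seminorm_scaleC: "A_seminorm A (a *\<^sub>C x) = cmod a * A_seminorm A x"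
proof -
  have "A_inner A (a *\<^sub>C x) (a *\<^sub>C x) = of_real ((cmod a)\<^sup>2) * A_inner A x x"
    by (simp add: A_inner_scaleC_left A_inner_scaleC_right complex_norm_square mult_ac
        del: of_real_power)
  then show ?thesis
    by (simp add: A_seminorm_def real_sqrt_mult)
qed

lemma A_seminorm_normalize:
  assumes "A_seminorm A x \<noteq> 0"
  shows "A_seminorm A (of_real (inverse (A_seminorm A x)) *\<^sub>C x) = 1"
  using assms A_seminorm_nonneg[of x] by (simp add: A_seminorm_scaleC norm_inverse)

text \<open>
  Over the complex numbers, a form that is real on the diagonal is Hermitian: that the value
  at \<open>x + y\<close> is real gives the equation of the imaginary parts, and that the value at \<open>x + i y\<close>
  is real gives the equation of the real parts.
\<close>

lemma A_inner_commute: "A_inner A x y = cnj (A_inner A y x)"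
proof (rule complex_eqI)
  show "Im (A_inner A x y) = Im (cnj (A_inner A y x))"
    using A_inner_self_real[of "x + y"] A_inner_self_real[of x] A_inner_self_real[of y]
    by (simp add: A_inner_add_left A_inner_add_right)
  show "Re (A_inner A x y) = Re (cnj (A_inner A y x))"
    using A_inner_self_real[of "x + \<i> *\<^sub>C y"] A_inner_self_real[of x] A_inner_self_real[of y]
    by (simp add: A_inner_add_left A_inner_add_right A_inner_scaleC_left A_inner_scaleC_right)
qed

lemma A_inner_Cauchy_Schwarz: "cmod (A_inner A x y) \<le> A_seminorm A x * A_seminorm A y"
proof -
  define p where "p = Re (A_inner A x x)"
  define q where "q = Re (A_inner A y y)"
  define b where "b = cmod (A_inner A x y)"
  \<comment> \<open>Rotating \<open>x\<close> by a suitable phase makes the mixed term equal to its modulus, so that the form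
    is a real quadratic form on the real span of \<open>x\<close> and \<open>y\<close>.\<close>
  obtain c where c: "cmod c = 1" "c * A_inner A x y = of_real b"
  proof (cases "A_inner A x y = 0")
    case True
    then show ?thesis using that[of 1] by (simp add: b_def)
  next
    case False
    have "cnj (sgn (A_inner A x y)) * A_inner A x y = of_real b"
      using False
      by (simp add: b_def sgn_eq field_simps complex_norm_square[symmetric] power2_eq_square)
    then show ?thesis
      using that[of "cnj (sgn (A_inner A x y))"] False by (simp add: norm_sgn)
  qed
  have c': "cnj c * A_inner A y x = of_real b"
    using arg_cong[OF c(2), of cnj] A_inner_commute[of y x] by simp
  have cc: "c * cnj c = 1"
    using c(1) by (simp add: complex_norm_square[symmetric])
  have quad: "0 \<le> s\<^sup>2 * p + 2 * s * t * b + t\<^sup>2 * q" for s t :: real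
  proof -
    let ?z = "(of_real s * c) *\<^sub>C x + of_real t *\<^sub>C y"
    have "A_inner A ?z ?z = of_real (s\<^sup>2) * (c * cnj c) * A_inner A x x
        + of_real (s * t) * (c * A_inner A x y) + of_real (s * t) * (cnj c * A_inner A y x)
        + of_real (t\<^sup>2) * A_inner A y y"
      by (simp add: A_inner_add_left A_inner_add_right A_inner_scaleC_left A_inner_scaleC_right
          algebra_simps power2_eq_square)
    also have "Re \<dots> = s\<^sup>2 * p + 2 * s * t * b + t\<^sup>2 * q"
      unfolding cc c(2) c' by (simp add: p_def q_def del: of_real_power of_real_mult)
    finally show ?thesis using A_inner_self_nonneg[of ?z] by simp
  qed
  have p0: "0 \<le> p" and q0: "0 \<le> q"
    by (simp_all add: p_def q_def A_inner_self_nonneg)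
  \<comment> \<open>If \<open>q \<noteq> 0\<close>, the quadratic form is tested at its minimiser in \<open>t\<close>, scaled by \<open>q\<close>. If
    \<open>q = 0\<close>, it is linear in \<open>t\<close>, and a sufficiently negative \<open>t\<close> forces \<open>b = 0\<close>.\<close>
  have "b\<^sup>2 \<le> p * q"
  proof (cases "q = 0")
    case True
    have "0 \<le> - (b\<^sup>2 * (p + 2))"
      using quad[of b "- (p + 1)"] True by (simp add: algebra_simps power2_eq_square)
    then have "b\<^sup>2 * (p + 2) \<le> 0" by simp
    then have "b\<^sup>2 \<le> 0" using p0 by (simp add: mult_le_0_iff)
    then show ?thesis using True by simp
  next
    case False
    have "0 \<le> q * (p * q - b\<^sup>2)"
      using quad[of q "- b"] by (simp add: algebra_simps power2_eq_square)
    then show ?thesis using False q0 by (simp add: zero_le_mult_iff)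
  qed
  then have "b\<^sup>2 \<le> (A_seminorm A x * A_seminorm A y)\<^sup>2"
    by (simp add: power_mult_distrib A_seminorm_sq p_def q_def)
  then show ?thesis
    unfolding b_def by (rule power2_le_imp_le) (simp add: A_seminorm_nonneg)
qed

end

section \<open>Operator seminorm and numerical radius as best constants\<close>

lemma A_numerical_radius_nonneg:
  assumes "bdd_above {cmod (A_inner A (T x) x) | x. A_seminorm A x = 1}"
  shows "0 \<le> A_numerical_radius A T"
  unfolding A_numerical_radius_def by (rule cSup_upper) (use assms in simp_all)

lemma A_numerical_radius_upper:
  assumes "bdd_above {cmod (A_inner A (T x) x) | x. A_seminorm A x = 1}"
    and "A_seminorm A x = 1"
  shows "cmod (A_inner A (T x) x) \<le> A_numerical_radius A T"
  unfolding A_numerical_radius_def by (rule cSup_upper) (use assms in auto)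

lemma A_numerical_radius_least:
  assumes "0 \<le> M" and "\<And>x. A_seminorm A x = 1 \<Longrightarrow> cmod (A_inner A (T x) x) \<le> M"
  shows "A_numerical_radius A T \<le> M"
  unfolding A_numerical_radius_def by (rule cSup_least) (use assms in auto)

context
  fixes A T :: "'a::complex_inner \<Rightarrow> 'a"
  assumes pos: "positive_op A" and T: "T \<in> A_bounded_ops A"
begin

lemma A_bounded_ops_bound:
  obtains c where "0 < c" "\<And>x. A_seminorm A (T x) \<le> c * A_seminorm A x"
  using T by (auto simp: A_bounded_ops_def)

lemma bdd_above_A_opnorm: "bdd_above {A_seminorm A (T x) | x. A_seminorm A x = 1}"
proof -
  obtain c where c: "\<And>x. A_seminorm A (T x) \<le> c * A_seminorm A x"
    using A_bounded_ops_bound by blast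
  show ?thesis
  proof (rule bdd_aboveI)
    fix r assume "r \<in> {A_seminorm A (T x) | x. A_seminorm A x = 1}"
    then obtain x where "A_seminorm A x = 1" "r = A_seminorm A (T x)" by blast
    then show "r \<le> c" using c[of x] by simp
  qed
qed

lemma A_opnorm_nonneg: "0 \<le> A_opnorm A T"
  unfolding A_opnorm_def by (rule cSup_upper) (simp_all add: bdd_above_A_opnorm)

lemma A_seminorm_le_opnorm: "A_seminorm A (T x) \<le> A_opnorm A T * A_seminorm A x"
proof (cases "A_seminorm A x = 0")
  case True
  then show ?thesis using A_bounded_ops_bound by (metis mult_zero_right)
next
  case False
  then have n: "0 < A_seminorm A x" using A_seminorm_nonneg[OF pos, of x] by simp
  let ?u = "of_real (inverse (A_seminorm A x)) *\<^sub>C x"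
  have "A_seminorm A (T ?u) \<le> A_opnorm A T"
    unfolding A_opnorm_def
    by (rule cSup_upper) (use A_seminorm_normalize[OF pos False] bdd_above_A_opnorm in auto)
  then have "inverse (A_seminorm A x) * A_seminorm A (T x) \<le> A_opnorm A T"
    using n
    by (simp add: bounded_clinear_scaleC[OF A_bounded_ops_clinear[OF T]] A_seminorm_scaleC[OF pos]
        norm_inverse)
  then show ?thesis using n by (simp add: field_simps)
qed

lemma A_inner_le_opnorm:
  "cmod (A_inner A (T x) y) \<le> A_opnorm A T * A_seminorm A x * A_seminorm A y"
  using A_inner_Cauchy_Schwarz[OF pos, of "T x" y]
    mult_right_mono[OF A_seminorm_le_opnorm A_seminorm_nonneg[OF pos], of x y]
  by linarith

lemma bdd_above_A_numerical_radius:
  "bdd_above {cmod (A_inner A (T x) x) | x. A_seminorm A x = 1}"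
proof (rule bdd_aboveI)
  fix r assume "r \<in> {cmod (A_inner A (T x) x) | x. A_seminorm A x = 1}"
  then obtain x where "A_seminorm A x = 1" "r = cmod (A_inner A (T x) x)" by blast
  then show "r \<le> A_opnorm A T"
    using A_inner_le_opnorm[of x x] by simp
qed

lemma A_inner_le_numerical_radius:
  "cmod (A_inner A (T x) x) \<le> A_numerical_radius A T * (A_seminorm A x)\<^sup>2"
proof (cases "A_seminorm A x = 0")
  case True
  then show ?thesis using A_inner_le_opnorm[of x x] by simp
next
  case False
  then have n: "0 < A_seminorm A x" using A_seminorm_nonneg[OF pos, of x] by simp
  let ?r = "inverse (A_seminorm A x)"
  let ?u = "of_real ?r *\<^sub>C x"
  have "cmod (A_inner A (T ?u) ?u) \<le> A_numerical_radius A T"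
    by (rule A_numerical_radius_upper[OF bdd_above_A_numerical_radius A_seminorm_normalize[OF pos False]])
  moreover have "cmod (A_inner A (T ?u) ?u) = ?r * (?r * cmod (A_inner A (T x) x))"
    using n
    by (simp add: bounded_clinear_scaleC[OF A_bounded_ops_clinear[OF T]]
        A_inner_scaleC_left[OF pos] A_inner_scaleC_right norm_mult norm_inverse)
  ultimately have "?r * (?r * cmod (A_inner A (T x) x)) \<le> A_numerical_radius A T"
    by (simp only:)
  then show ?thesis
    using n by (simp add: field_simps power2_eq_square)
qed

end

section \<open>Block operators\<close>

lemma A_inner_block_op:
  assumes "positive_op A"
  shows "A_inner (diag_op A) (block_op P Q R S (u, v)) (u, v) =
    A_inner A (P u) u + A_inner A (Q v) u + A_inner A (R u) v + A_inner A (S v) v"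
  by (simp add: A_inner_diag_op) (simp add: block_op_def A_inner_add_left[OF assms])

lemma A_seminorm_diag_op:
  assumes "positive_op A"
  shows "A_seminorm (diag_op A) (u, v) = sqrt ((A_seminorm A u)\<^sup>2 + (A_seminorm A v)\<^sup>2)"
  by (simp add: A_seminorm_def[of "diag_op A"] A_inner_diag_op A_seminorm_sq[OF assms])

text \<open>
  Besides giving the upper bound, this inequality shows that the supremum defining the numerical
  radius of the block operator is taken over a bounded set, which the lower bound relies on.
\<close>

lemma block_form_le:
  fixes A P Q R S :: "'a::complex_inner \<Rightarrow> 'a"
  assumes pos: "positive_op A"
    and ops: "P \<in> A_bounded_ops A" "Q \<in> A_bounded_ops A" "R \<in> A_bounded_ops A" "S \<in> A_bounded_ops A"
    and unit: "A_seminorm (diag_op A) x = 1"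
  shows "cmod (A_inner (diag_op A) (block_op P Q R S x) x)
    \<le> (A_opnorm A Q + A_opnorm A R) / 2 + max (A_numerical_radius A P) (A_numerical_radius A S)"
proof -
  obtain u v where x: "x = (u, v)" by (cases x)
  define a where "a = A_seminorm A u"
  define b where "b = A_seminorm A v"
  define w where "w = max (A_numerical_radius A P) (A_numerical_radius A S)"
  have ab: "a\<^sup>2 + b\<^sup>2 = 1"
    using unit by (simp add: x A_seminorm_diag_op[OF pos] a_def b_def)
  have P: "cmod (A_inner A (P u) u) \<le> w * a\<^sup>2"
    using A_inner_le_numerical_radius[OF pos ops(1), of u]
      mult_right_mono[of "A_numerical_radius A P" w "a\<^sup>2"]
    by (simp add: w_def a_def)
  have S: "cmod (A_inner A (S v) v) \<le> w * b\<^sup>2"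
    using A_inner_le_numerical_radius[OF pos ops(4), of v]
      mult_right_mono[of "A_numerical_radius A S" w "b\<^sup>2"]
    by (simp add: w_def b_def)
  have Q: "cmod (A_inner A (Q v) u) \<le> A_opnorm A Q * (a * b)"
    using A_inner_le_opnorm[OF pos ops(2), of v u] by (simp add: a_def b_def mult_ac)
  have R: "cmod (A_inner A (R u) v) \<le> A_opnorm A R * (a * b)"
    using A_inner_le_opnorm[OF pos ops(3), of u v] by (simp add: a_def b_def mult_ac)
  have "a * b \<le> 1 / 2"
    using sum_squares_bound[of a b] ab by simp
  then have QR: "(A_opnorm A Q + A_opnorm A R) * (a * b) \<le> (A_opnorm A Q + A_opnorm A R) * (1 / 2)"
    by (intro mult_left_mono) (simp_all add: A_opnorm_nonneg[OF pos] ops)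
  have "cmod (A_inner (diag_op A) (block_op P Q R S x) x)
      \<le> cmod (A_inner A (P u) u) + cmod (A_inner A (Q v) u) + cmod (A_inner A (R u) v)
        + cmod (A_inner A (S v) v)"
    unfolding x A_inner_block_op[OF pos] by (intro norm_triangle_le add_right_mono) simp
  also have "\<dots> \<le> w * (a\<^sup>2 + b\<^sup>2) + (A_opnorm A Q + A_opnorm A R) * (a * b)"
    using P Q R S by (simp add: algebra_simps)
  also have "\<dots> \<le> w + (A_opnorm A Q + A_opnorm A R) / 2"
    using QR by (simp add: ab)
  finally show ?thesis by (simp add: w_def)
qed

theorem theorem2p1:
  fixes A P Q R S :: "'a::chilbert_space \<Rightarrow> 'a"
  assumes "positive_op A"
    and "P \<in> A_bounded_ops A" and "Q \<in> A_bounded_ops A"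
    and "R \<in> A_bounded_ops A" and "S \<in> A_bounded_ops A"
  shows "max (A_numerical_radius (diag_op A) (block_op zero_op Q R zero_op))
             (max (A_numerical_radius A P) (A_numerical_radius A S))
           \<le> A_numerical_radius (diag_op A) (block_op P Q R S)
       \<and> A_numerical_radius (diag_op A) (block_op P Q R S)
           \<le> (A_opnorm A Q + A_opnorm A R) / 2
              + max (A_numerical_radius A P) (A_numerical_radius A S)"
proof -
  note pos = assms(1) and ops = assms(2-5)
  note block = A_inner_block_op[OF pos]
  let ?D = "diag_op A" and ?T = "block_op P Q R S"
  let ?w = "A_numerical_radius ?D ?T"
  note zero_ops = ops[THEN A_bounded_ops_clinear, THEN bounded_clinear_zero]
  note minus_ops = ops[THEN A_bounded_ops_clinear, THEN bounded_clinear_minus]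
  have bdd: "bdd_above {cmod (A_inner ?D (?T x) x) | x. A_seminorm ?D x = 1}"
    by (rule bdd_aboveI) (use block_form_le[OF pos ops] in blast)
  note w = A_numerical_radius_upper[OF bdd]
  have w0: "0 \<le> ?w"
    by (rule A_numerical_radius_nonneg[OF bdd])

  have "A_numerical_radius A P \<le> ?w"
  proof (rule A_numerical_radius_least[OF w0])
    fix u assume "A_seminorm A u = 1"
    then show "cmod (A_inner A (P u) u) \<le> ?w"
      using w[of "(u, 0)"]
      by (simp add: block A_seminorm_diag_op[OF pos] A_seminorm_zero[OF pos] A_inner_zero_right
          A_inner_zero_left[OF pos] zero_ops)
  qed
  moreover have "A_numerical_radius A S \<le> ?w"
  proof (rule A_numerical_radius_least[OF w0])
    fix v assume "A_seminorm A v = 1"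
    then show "cmod (A_inner A (S v) v) \<le> ?w"
      using w[of "(0, v)"]
      by (simp add: block A_seminorm_diag_op[OF pos] A_seminorm_zero[OF pos] A_inner_zero_right
          A_inner_zero_left[OF pos] zero_ops)
  qed
  moreover have "A_numerical_radius ?D (block_op zero_op Q R zero_op) \<le> ?w"
  proof (rule A_numerical_radius_least[OF w0])
    fix x assume unit: "A_seminorm ?D x = 1"
    obtain u v where x: "x = (u, v)" by (cases x)
    have unit': "A_seminorm ?D (u, - v) = 1"
      using unit by (simp add: x A_seminorm_diag_op[OF pos] A_seminorm_minus[OF pos])
    have "2 * A_inner ?D (block_op zero_op Q R zero_op x) x =
        A_inner ?D (?T x) x - A_inner ?D (?T (u, - v)) (u, - v)"
      unfolding x block
      by (simp add: minus_ops A_inner_minus_left[OF pos] A_inner_minus_right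
          A_inner_zero_left[OF pos])
    then have "2 * cmod (A_inner ?D (block_op zero_op Q R zero_op x) x)
        = cmod (A_inner ?D (?T x) x - A_inner ?D (?T (u, - v)) (u, - v))"
      by (metis norm_mult norm_numeral)
    also have "\<dots> \<le> ?w + ?w"
      using norm_triangle_ineq4 add_mono[OF w[OF unit] w[OF unit']] by (rule order_trans)
    finally show "cmod (A_inner ?D (block_op zero_op Q R zero_op x) x) \<le> ?w"
      by simp
  qed
  moreover have "?w \<le> (A_opnorm A Q + A_opnorm A R) / 2
      + max (A_numerical_radius A P) (A_numerical_radius A S)"
  proof (rule A_numerical_radius_least)
    have "0 \<le> A_numerical_radius A P"
      by (rule A_numerical_radius_nonneg[OF bdd_above_A_numerical_radius[OF pos ops(1)]])
    then show "0 \<le> (A_opnorm A Q + A_opnorm A R) / 2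
        + max (A_numerical_radius A P) (A_numerical_radius A S)"
      using A_opnorm_nonneg[OF pos ops(2)] A_opnorm_nonneg[OF pos ops(3)] by simp
  qed (rule block_form_le[OF pos ops])
  ultimately show ?thesis by simp
qed

end
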